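(* Let $n\ge1$. ($\alpha$) For each $b\ge1$, the function $S(n)\ni\sigma\mapsto b^{h_n(\sigma)}$ is positive definite on $S(n)$. ($\beta$) The function $H_n(\sigma)=n-h_n(\sigma)$ is conditionally negative definite on $S(n)$, i.e. $\sigma\mapsto\exp(-xH_n(\sigma))$ is positive definite on $S(n)$ for all $x>0$. ($\gamma$) The functions $H_n$ induce a well-defined function on $S(\infty)=\bigcup_n S(n)$: under the natural embedding $S(n)\subset S(n+1)$ one has $H_n=H_{n+1}|_{S(n)}$, so one can define $H:S(\infty)\to\mathbb{R}$ by $H(\sigma)=H_n(\sigma)=n-h_n(\sigma)$ for $\sigma\in S(n)$.
   Context: $S(n)$ is the group of permutations of $\{1,\dots,n\}$, embedded in $S(n+1)$ as the permutations fixing $n+1$. For $\sigma\in S(n)$ let $j(\sigma)=\{(k,\,2n+1-\sigma(k)):k=1,\dots,n\}$, a pair-partition of $\{1,\dots,2n\}$ (a partition into blocks of size two, written $(i,j)$ with $i<j$). Two blocks $(i_1,j_1),(i_2,j_2)$ cross if $i_1<i_2<j_1<j_2$ or $i_2<i_1<j_2<j_1$. A block is a singleton if it crosses no other block, and $h_n(\sigma)$ is the number of singletons of $j(\sigma)$. A function $\varphi$ on a group $\Gamma$ is positive definite if $\sum_{i,l}\varphi(g_i^{-1}g_l)\overline{z_i}z_l\ge0$ for all finite families $g_i\in\Gamma$, $z_i\in\mathbb{C}$. *)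

theory Defs
  imports
    Complex_Main
    "HOL-Library.FuncSet"
    "HOL-Library.Nonpos_Ints"
    "HOL-Algebra.Sym_Groups"
begin

text \<open>
  A block \<open>{i, j}\<close> with \<open>i < j\<close> is encoded as the ordered pair \<open>(i, j)\<close>.
\<close>

definition crosses :: "nat \<times> nat \<Rightarrow> nat \<times> nat \<Rightarrow> bool" where
  "crosses B B' \<longleftrightarrow>
     (fst B < fst B' \<and> fst B' < snd B \<and> snd B < snd B') \<or>
     (fst B' < fst B \<and> fst B < snd B' \<and> snd B' < snd B)"

definition singletons :: "(nat \<times> nat) set \<Rightarrow> (nat \<times> nat) set" where
  "singletons V = {B \<in> V. \<forall>B' \<in> V - {B}. \<not> crosses B B'}"

text \<open>
  For \<open>\<sigma>\<close> permuting \<open>{1..n}\<close> and \<open>1 \<le> k \<le> n\<close> one has \<open>k \<le> n < 2 * n + 1 - \<sigma> k\<close>, so the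
  subtraction never truncates and the smaller element of each block comes first.
\<close>

definition pair_partition :: "nat \<Rightarrow> (nat \<Rightarrow> nat) \<Rightarrow> (nat \<times> nat) set" where
  "pair_partition n \<sigma> = {(k, 2 * n + 1 - \<sigma> k) | k. k \<in> {1..n}}"

definition h :: "nat \<Rightarrow> (nat \<Rightarrow> nat) \<Rightarrow> nat" where
  "h n \<sigma> = card (singletons (pair_partition n \<sigma>))"

definition H :: "nat \<Rightarrow> (nat \<Rightarrow> nat) \<Rightarrow> real" where
  "H n \<sigma> = real n - real (h n \<sigma>)"

text \<open>
  Permutations of \<open>{1..n}\<close> are functions on all of \<open>nat\<close> that are the identity outside
  \<open>{1..n}\<close>, so the natural embedding of the symmetric group of degree \<open>n\<close> into that of
  degree \<open>n + 1\<close> is the inclusion of carriers.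
\<close>

definition S_infinity :: "(nat \<Rightarrow> nat) set" where
  "S_infinity = (\<Union>n \<in> {1..}. carrier (sym_group n))"

definition positive_definite :: "('a, 'm) monoid_scheme \<Rightarrow> ('a \<Rightarrow> complex) \<Rightarrow> bool" where
  "positive_definite G \<phi> \<longleftrightarrow>
     (\<forall>(m :: nat) (g :: nat \<Rightarrow> 'a) (z :: nat \<Rightarrow> complex). (\<forall>i<m. g i \<in> carrier G) \<longrightarrow>
        (\<Sum>i<m. \<Sum>l<m. \<phi> (inv\<^bsub>G\<^esub> (g i) \<otimes>\<^bsub>G\<^esub> g l) * cnj (z i) * z l) \<in> \<real>\<^sub>\<ge>\<^sub>0)"

definition conditionally_negative_definite ::
    "('a, 'm) monoid_scheme \<Rightarrow> ('a \<Rightarrow> complex) \<Rightarrow> bool" where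
  "conditionally_negative_definite G \<psi> \<longleftrightarrow>
     (\<forall>g \<in> carrier G. \<psi> (inv\<^bsub>G\<^esub> g) = cnj (\<psi> g)) \<and>
     (\<forall>(m :: nat) (g :: nat \<Rightarrow> 'a) (z :: nat \<Rightarrow> complex).
        (\<forall>i<m. g i \<in> carrier G) \<longrightarrow> (\<Sum>i<m. z i) = 0 \<longrightarrow>
        (\<Sum>i<m. \<Sum>l<m. \<psi> (inv\<^bsub>G\<^esub> (g i) \<otimes>\<^bsub>G\<^esub> g l) * cnj (z i) * z l) \<in> \<real>\<^sub>\<le>\<^sub>0)"

end

theory Submission
  imports Defs
begin

text \<open>
  Two blocks of the pair-partition of a permutation cross exactly when their indices form an
  inversion. So the block of \<open>k\<close> is a singleton iff \<open>k\<close> takes part in no inversion, that is, iff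
  \<open>\<sigma>\<close> fixes \<open>k\<close> and preserves both sides of \<open>k\<close>. These permutations form a subgroup, hence \<open>h\<close>
  is a sum of indicators of subgroups \<open>K\<^sub>k\<close>, and \<open>b ^ h = (\<Prod>k. 1 + (b - 1) * 1\<^sub>K\<^sub>k)\<close> expands into a
  nonnegative combination of indicators of intersections of them. Indicators of subgroups are
  positive definite: the quadratic form splits into squares over the left cosets.
\<close>

section \<open>Positive definite functions\<close>

lemma positive_definiteD:
  fixes m :: nat
  assumes "positive_definite G \<phi>" and "\<And>i. i < m \<Longrightarrow> g i \<in> carrier G"
  shows "(\<Sum>i<m. \<Sum>l<m. \<phi> (inv\<^bsub>G\<^esub> (g i) \<otimes>\<^bsub>G\<^esub> g l) * cnj (z i) * z l) \<in> \<real>\<^sub>\<ge>\<^sub>0"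
  using assms by (simp add: positive_definite_def)

text \<open>In a group every argument \<open>inv (g i) \<otimes> g l\<close> lies in the carrier, so
  formulas for \<open>h\<close> that hold only for permutations may be substituted.\<close>

lemma positive_definite_cong:
  assumes "group G" and "\<And>x. x \<in> carrier G \<Longrightarrow> \<phi> x = \<psi> x"
  shows "positive_definite G \<phi> \<longleftrightarrow> positive_definite G \<psi>"
proof -
  interpret group G by fact
  have "(\<Sum>i<m. \<Sum>l<m. \<phi> (inv\<^bsub>G\<^esub> (g i) \<otimes>\<^bsub>G\<^esub> g l) * cnj (z i) * z l) =
        (\<Sum>i<m. \<Sum>l<m. \<psi> (inv\<^bsub>G\<^esub> (g i) \<otimes>\<^bsub>G\<^esub> g l) * cnj (z i) * z l)"
    if "\<forall>i<m. g i \<in> carrier G" for m :: nat and g and z :: "nat \<Rightarrow> complex"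
    using that assms(2) by (intro sum.cong) auto
  then show ?thesis
    by (simp add: positive_definite_def)
qed

lemma positive_definite_cmult:
  assumes "positive_definite G \<phi>" and "c \<ge> 0"
  shows "positive_definite G (\<lambda>x. complex_of_real c * \<phi> x)"
  unfolding positive_definite_def
proof (intro allI impI)
  fix m :: nat and g :: "nat \<Rightarrow> 'a" and z :: "nat \<Rightarrow> complex"
  assume "\<forall>i<m. g i \<in> carrier G"
  with assms(1) have "(\<Sum>i<m. \<Sum>l<m. \<phi> (inv\<^bsub>G\<^esub> (g i) \<otimes>\<^bsub>G\<^esub> g l) * cnj (z i) * z l) \<in> \<real>\<^sub>\<ge>\<^sub>0"
    by (intro positive_definiteD) auto
  with \<open>c \<ge> 0\<close>
  have "complex_of_real c * (\<Sum>i<m. \<Sum>l<m. \<phi> (inv\<^bsub>G\<^esub> (g i) \<otimes>\<^bsub>G\<^esub> g l) * cnj (z i) * z l) \<in> \<real>\<^sub>\<ge>\<^sub>0"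
    by (intro nonneg_Reals_mult_I) auto
  then show "(\<Sum>i<m. \<Sum>l<m. complex_of_real c * \<phi> (inv\<^bsub>G\<^esub> (g i) \<otimes>\<^bsub>G\<^esub> g l) * cnj (z i) * z l) \<in> \<real>\<^sub>\<ge>\<^sub>0"
    by (simp add: sum_distrib_left mult.assoc)
qed

lemma positive_definite_sum:
  fixes G :: "('a, 'm) monoid_scheme"
  assumes "\<And>a. a \<in> A \<Longrightarrow> positive_definite G (\<phi> a)"
  shows "positive_definite G (\<lambda>x. \<Sum>a\<in>A. \<phi> a x)"
  unfolding positive_definite_def
proof (intro allI impI)
  fix m :: nat and g :: "nat \<Rightarrow> 'a" and z :: "nat \<Rightarrow> complex"
  let ?Q = "\<lambda>a i l. \<phi> a (inv\<^bsub>G\<^esub> (g i) \<otimes>\<^bsub>G\<^esub> g l) * cnj (z i) * z l"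
  assume g: "\<forall>i<m. g i \<in> carrier G"
  have "(\<Sum>i<m. \<Sum>l<m. (\<Sum>a\<in>A. \<phi> a (inv\<^bsub>G\<^esub> (g i) \<otimes>\<^bsub>G\<^esub> g l)) * cnj (z i) * z l) =
        (\<Sum>i<m. \<Sum>a\<in>A. \<Sum>l<m. ?Q a i l)"
    unfolding sum_distrib_right by (intro sum.cong refl sum.swap)
  also have "\<dots> = (\<Sum>a\<in>A. \<Sum>i<m. \<Sum>l<m. ?Q a i l)"
    by (rule sum.swap)
  also have "\<dots> \<in> \<real>\<^sub>\<ge>\<^sub>0"
  proof -
    have "(\<Sum>i<m. \<Sum>l<m. ?Q a i l) \<in> \<real>\<^sub>\<ge>\<^sub>0" if "a \<in> A" for a
      using assms[OF that] g by (intro positive_definiteD) auto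
    then show ?thesis
      \<comment> \<open>For infinite \<open>A\<close> the outer sum has the default value 0, which
        is nonnegative too.\<close>
      by (induction A rule: infinite_finite_induct) auto
  qed
  finally show "(\<Sum>i<m. \<Sum>l<m. (\<Sum>a\<in>A. \<phi> a (inv\<^bsub>G\<^esub> (g i) \<otimes>\<^bsub>G\<^esub> g l)) * cnj (z i) * z l) \<in> \<real>\<^sub>\<ge>\<^sub>0" .
qed

section \<open>Indicators of subgroups and powers counting memberships\<close>

text \<open>Makes the matrix of the form for the indicator of \<open>K\<close> the matrix of an
  equivalence relation, with one block per left coset.\<close>

lemma (in group) inv_mult_mem_iff_l_coset_eq:
  assumes "subgroup K G" and "x \<in> carrier G" and "y \<in> carrier G"
  shows "inv x \<otimes> y \<in> K \<longleftrightarrow> x <# K = y <# K"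
proof
  interpret K: subgroup K G by fact
  show "x <# K = y <# K" if "inv x \<otimes> y \<in> K"
  proof (rule l_repr_independence)
    have "y = x \<otimes> (inv x \<otimes> y)"
      using assms by (simp add: m_assoc[symmetric])
    with that show "y \<in> x <# K"
      unfolding l_coset_def by blast
  qed (use assms in auto)
  show "inv x \<otimes> y \<in> K" if eq: "x <# K = y <# K"
  proof -
    have "y \<otimes> \<one> \<in> y <# K"
      unfolding l_coset_def using K.one_closed by blast
    with eq have "y \<in> x <# K"
      using assms by simp
    then obtain k where "k \<in> K" "y = x \<otimes> k"
      unfolding l_coset_def by blast
    then show ?thesis
      using assms K.subset by (simp add: m_assoc[symmetric] subset_iff)
  qed
qed

lemma (in group) positive_definite_subgroup:
  assumes "subgroup K G"
  shows "positive_definite G (\<lambda>x. of_bool (x \<in> K))"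
  unfolding positive_definite_def
proof (intro allI impI)
  fix m :: nat and g :: "nat \<Rightarrow> 'a" and z :: "nat \<Rightarrow> complex"
  assume g: "\<forall>i<m. g i \<in> carrier G"
  define c where "c i = g i <# K" for i
  \<comment> \<open>\<open>w C\<close> is the total weight of the indices falling in the coset
    \<open>C\<close>; the form will be the sum of its squared moduli.\<close>
  define w where "w C = (\<Sum>l | l \<in> {..<m} \<and> c l = C. z l)" for C
  have "(\<Sum>i<m. \<Sum>l<m. of_bool (inv (g i) \<otimes> g l \<in> K) * cnj (z i) * z l) =
        (\<Sum>i<m. \<Sum>l<m. of_bool (c i = c l) * cnj (z i) * z l)"
    using g assms by (intro sum.cong refl) (simp add: inv_mult_mem_iff_l_coset_eq c_def)
  also have "\<dots> = (\<Sum>i<m. cnj (z i) * w (c i))"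
  proof (intro sum.cong refl)
    fix i
    have "(\<Sum>l<m. of_bool (c i = c l) * cnj (z i) * z l) =
          cnj (z i) * (\<Sum>l<m. if c l = c i then z l else 0)"
      unfolding sum_distrib_left by (intro sum.cong refl) auto
    then show "(\<Sum>l<m. of_bool (c i = c l) * cnj (z i) * z l) = cnj (z i) * w (c i)"
      unfolding w_def by (subst sum.inter_filter) simp_all
  qed
  also have "\<dots> = (\<Sum>C\<in>c ` {..<m}. \<Sum>i | i \<in> {..<m} \<and> c i = C. cnj (z i) * w (c i))"
    by (rule sum.image_gen) simp
  \<comment> \<open>On the fibre over \<open>C\<close> the factor \<open>w (c i)\<close> is
    constant, and the remaining \<open>cnj (z i)\<close> add up to \<open>cnj (w C)\<close>.\<close>
  also have "\<dots> = (\<Sum>C\<in>c ` {..<m}. cnj (w C) * w C)"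
    by (intro sum.cong refl) (simp add: w_def sum_distrib_right)
  also have "\<dots> = complex_of_real (\<Sum>C\<in>c ` {..<m}. (cmod (w C))\<^sup>2)"
    by (simp add: complex_norm_square mult.commute del: of_real_power)
  also have "\<dots> \<in> \<real>\<^sub>\<ge>\<^sub>0"
    by (simp only: nonneg_Reals_of_real_iff) (simp add: sum_nonneg)
  finally show "(\<Sum>i<m. \<Sum>l<m. of_bool (inv (g i) \<otimes> g l \<in> K) * cnj (z i) * z l) \<in> \<real>\<^sub>\<ge>\<^sub>0" .
qed

lemma (in group) positive_definite_power_card_subgroups:
  fixes K :: "'k \<Rightarrow> 'a set"
  assumes "finite I" and K: "\<And>k. k \<in> I \<Longrightarrow> subgroup (K k) G" and "b \<ge> 1"
  shows "positive_definite G (\<lambda>x. complex_of_real (b ^ card {k \<in> I. x \<in> K k}))"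
proof -
  \<comment> \<open>For empty \<open>A\<close> the intersection is \<open>UNIV\<close>; cutting with
    the carrier makes that term the whole group.\<close>
  define L where "L A = (\<Inter>k\<in>A. K k) \<inter> carrier G" for A
  have L: "subgroup (L A) G" if "A \<subseteq> I" for A
  proof
    have K': "subgroup (K k) G" if "k \<in> A" for k
      using K \<open>A \<subseteq> I\<close> that by blast
    show "L A \<subseteq> carrier G" "\<one> \<in> L A"
      using subgroup.one_closed[OF K'] by (auto simp: L_def)
    show "x \<otimes> y \<in> L A" if "x \<in> L A" "y \<in> L A" for x y
      using subgroup.m_closed[OF K'] that by (auto simp: L_def)
    show "inv x \<in> L A" if "x \<in> L A" for x
      using subgroup.m_inv_closed[OF K'] that by (auto simp: L_def)
  qed
  have "b ^ card {k \<in> I. x \<in> K k} = (\<Sum>A\<in>Pow I. (b - 1) ^ card A * of_bool (x \<in> L A))"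
    if x: "x \<in> carrier G" for x
  proof -
    have "b ^ card {k \<in> I. x \<in> K k} = (\<Prod>k\<in>I. if x \<in> K k then b else 1)"
      using \<open>finite I\<close> by (simp add: prod.inter_filter[symmetric])
    \<comment> \<open>In this form the product expands over the subsets \<open>A\<close> of
      \<open>I\<close>; a term survives only if \<open>x\<close> lies in every \<open>K k\<close>
      with \<open>k\<close> in \<open>A\<close>.\<close>
    also have "\<dots> = (\<Prod>k\<in>I. (b - 1) * of_bool (x \<in> K k) + 1)"
      by (intro prod.cong) auto
    also have "\<dots> = (\<Sum>A\<in>Pow I. \<Prod>k\<in>A. (b - 1) * of_bool (x \<in> K k))"
      using \<open>finite I\<close> by (simp add: prod_add)
    also have "\<dots> = (\<Sum>A\<in>Pow I. (b - 1) ^ card A * of_bool (x \<in> L A))"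
    proof (intro sum.cong refl)
      fix A assume "A \<in> Pow I"
      then have "finite A"
        using \<open>finite I\<close> finite_subset by auto
      then show "(\<Prod>k\<in>A. (b - 1) * of_bool (x \<in> K k)) = (b - 1) ^ card A * of_bool (x \<in> L A)"
        using x by (auto simp: L_def prod.distrib prod_zero_iff)
    qed
    finally show ?thesis .
  qed
  moreover have of_real_of_bool: "complex_of_real (of_bool P) = of_bool P" for P
    by (cases P) simp_all
  ultimately have "positive_definite G (\<lambda>x. complex_of_real (b ^ card {k \<in> I. x \<in> K k})) \<longleftrightarrow>
    positive_definite G (\<lambda>x. \<Sum>A\<in>Pow I. complex_of_real ((b - 1) ^ card A) * of_bool (x \<in> L A))"
    by (intro positive_definite_cong is_group) (simp add: of_real_of_bool del: of_real_power)
  also have "\<dots>"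
    \<comment> \<open>Here \<open>b \<ge> 1\<close> makes all coefficients
      \<open>(b - 1) ^ card A\<close> nonnegative.\<close>
    using \<open>b \<ge> 1\<close> L
    by (intro positive_definite_sum positive_definite_cmult positive_definite_subgroup) auto
  finally show ?thesis .
qed

text \<open>On weights of sum zero the constant contributes nothing, so the form is minus that of
  \<open>\<phi>\<close>. The second assumption supplies the Hermitian clause of the
  definition.\<close>

lemma (in group) conditionally_negative_definite_const_minus:
  assumes "positive_definite G \<phi>" and "\<And>x. x \<in> carrier G \<Longrightarrow> \<phi> (inv x) = cnj (\<phi> x)"
  shows "conditionally_negative_definite G (\<lambda>x. complex_of_real a - \<phi> x)"
  unfolding conditionally_negative_definite_def
proof (intro conjI ballI allI impI)
  fix m :: nat and g :: "nat \<Rightarrow> 'a" and z :: "nat \<Rightarrow> complex"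
  assume g: "\<forall>i<m. g i \<in> carrier G" and z: "(\<Sum>i<m. z i) = 0"
  let ?S = "\<Sum>i<m. \<Sum>l<m. \<phi> (inv (g i) \<otimes> g l) * cnj (z i) * z l"
  have "(\<Sum>i<m. \<Sum>l<m. (complex_of_real a - \<phi> (inv (g i) \<otimes> g l)) * cnj (z i) * z l) =
        (\<Sum>i<m. complex_of_real a * cnj (z i) * (\<Sum>l<m. z l)) - ?S"
    by (simp add: algebra_simps sum_subtractf sum_distrib_left)
  also have "\<dots> = - ?S"
    by (simp add: z)
  also have "\<dots> \<in> \<real>\<^sub>\<le>\<^sub>0"
    using positive_definiteD[OF assms(1), of m g z] g by simp
  finally show "(\<Sum>i<m. \<Sum>l<m. (complex_of_real a - \<phi> (inv (g i) \<otimes> g l)) * cnj (z i) * z l) \<in> \<real>\<^sub>\<le>\<^sub>0" .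
qed (use assms(2) in simp)

section \<open>Singleton blocks of a permutation\<close>

text \<open>The quantifier ranges over all naturals, not over \<open>{1..n}\<close>, so that the
  predicate is independent of the degree.\<close>

definition splits_at :: "nat \<Rightarrow> (nat \<Rightarrow> nat) \<Rightarrow> bool" where
  "splits_at k \<sigma> \<longleftrightarrow> \<sigma> k = k \<and> (\<forall>i. \<sigma> i < k \<longleftrightarrow> i < k)"

text \<open>If \<open>k\<close> is in no inversion, \<open>\<sigma>\<close> maps the numbers below
  \<open>k\<close> bijectively onto those below \<open>\<sigma> k\<close>; comparing cardinalities
  gives \<open>\<sigma> k = k\<close>.\<close>

lemma splits_at_iff_no_inversion:
  assumes "\<sigma> permutes {1..n}" and "k \<in> {1..n}"
  shows "splits_at k \<sigma> \<longleftrightarrow> (\<forall>i\<in>{1..n}. i < k \<longleftrightarrow> \<sigma> i < \<sigma> k)"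
proof
  assume *: "\<forall>i\<in>{1..n}. i < k \<longleftrightarrow> \<sigma> i < \<sigma> k"
  have \<sigma>k: "\<sigma> k \<in> {1..n}"
    using assms permutes_in_image by metis
  \<comment> \<open>Outside \<open>{1..n}\<close> the point \<open>i\<close> is fixed and lies below
    both \<open>k\<close> and \<open>\<sigma> k\<close> (if 0) or above both (if larger than
    \<open>n\<close>).\<close>
  have lt: "\<sigma> i < \<sigma> k \<longleftrightarrow> i < k" for i
    using * \<sigma>k assms permutes_not_in[OF assms(1), of i] by (cases "i \<in> {1..n}") auto
  have "\<sigma> ` {..<k} = {..<\<sigma> k}"
  proof (intro equalityI subsetI)
    fix j assume "j \<in> {..<\<sigma> k}"
    moreover have "j = \<sigma> (inv' \<sigma> j)"
      using permutes_inverses(1)[OF assms(1)] by simp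
    ultimately show "j \<in> \<sigma> ` {..<k}"
      using lt by (metis imageI lessThan_iff)
  qed (use lt in auto)
  then have "k = \<sigma> k"
    using card_image[OF permutes_inj_on[OF assms(1)], of "{..<k}"] by simp
  with lt show "splits_at k \<sigma>"
    unfolding splits_at_def by metis
qed (auto simp: splits_at_def)

text \<open>Left endpoints are at most \<open>n\<close> and right endpoints exceed \<open>n\<close>,
  so the middle inequality of a crossing is automatic. The reflection \<open>2 * n + 1 - _\<close>
  reverses the order of the values of \<open>\<sigma>\<close>.\<close>

lemma crosses_pair_partition_iff:
  assumes "\<sigma> permutes {1..n}" and "k \<in> {1..n}" and "l \<in> {1..n}"
  shows "crosses (k, 2 * n + 1 - \<sigma> k) (l, 2 * n + 1 - \<sigma> l) \<longleftrightarrow>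
    k < l \<and> \<sigma> l < \<sigma> k \<or> l < k \<and> \<sigma> k < \<sigma> l"
proof -
  have "\<sigma> k \<in> {1..n}" "\<sigma> l \<in> {1..n}"
    using assms by (simp_all only: permutes_in_image)
  with assms show ?thesis
    by (auto simp: crosses_def)
qed

lemma h_eq:
  assumes "\<sigma> permutes {1..n}"
  shows "h n \<sigma> = card {k \<in> {1..n}. splits_at k \<sigma>}"
proof -
  let ?B = "\<lambda>k. (k, 2 * n + 1 - \<sigma> k)"
  have inj: "\<sigma> i = \<sigma> k \<longleftrightarrow> i = k" for i k
    using permutes_inj[OF assms] by (auto dest: injD)
  have no_crossing: "(\<forall>l\<in>{1..n} - {k}. \<not> crosses (?B k) (?B l)) \<longleftrightarrow> splits_at k \<sigma>"
    if k: "k \<in> {1..n}" for k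
  proof -
    \<comment> \<open>Since \<open>l\<close> differs from \<open>k\<close>, injectivity excludes
      \<open>\<sigma> l = \<sigma> k\<close>, so having no inversion means that both orders
      agree.\<close>
    have "\<not> crosses (?B k) (?B l) \<longleftrightarrow> (l < k \<longleftrightarrow> \<sigma> l < \<sigma> k)" if "l \<in> {1..n} - {k}" for l
      using that inj[of l k] crosses_pair_partition_iff[OF assms k, of l] by auto
    then show ?thesis
      unfolding splits_at_iff_no_inversion[OF assms k] by auto
  qed
  have "pair_partition n \<sigma> = ?B ` {1..n}"
    by (auto simp: pair_partition_def)
  \<comment> \<open>The first component of a block recovers its index, so removing the block of
    \<open>k\<close> amounts to removing \<open>k\<close>.\<close>
  then have "singletons (pair_partition n \<sigma>) =
      ?B ` {k \<in> {1..n}. \<forall>l\<in>{1..n} - {k}. \<not> crosses (?B k) (?B l)}"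
    unfolding singletons_def by auto
  also have "\<dots> = ?B ` {k \<in> {1..n}. splits_at k \<sigma>}"
    using no_crossing by (intro image_cong Collect_cong conj_cong refl)
  finally show ?thesis
    unfolding h_def by (simp add: card_image inj_on_def)
qed

text \<open>A permutation of \<open>{1..n}\<close> splits at every point outside that interval, so
  the points counted by \<open>n - h n \<sigma>\<close> are all the non-splitting naturals. The
  count no longer mentions \<open>n\<close>, which is the source of stability.\<close>

lemma H_eq:
  assumes "\<sigma> permutes {1..n}"
  shows "H n \<sigma> = card {k. \<not> splits_at k \<sigma>}"
proof -
  have "splits_at k \<sigma>" if "k \<notin> {1..n}" for k
  proof (cases "k = 0")
    case True
    then show ?thesis
      using permutes_not_in[OF assms, of 0] by (simp add: splits_at_def)
  next
    case False
    with that have "k > n" by auto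
    have "\<sigma> i < k \<longleftrightarrow> i < k" for i
    proof (cases "i \<in> {1..n}")
      case True
      then have "\<sigma> i \<in> {1..n}"
        using assms by (simp only: permutes_in_image)
      with True \<open>k > n\<close> show ?thesis by auto
    qed (simp add: permutes_not_in[OF assms])
    then show ?thesis
      using permutes_not_in[OF assms that] by (simp add: splits_at_def)
  qed
  then have "{k. \<not> splits_at k \<sigma>} = {1..n} - {k \<in> {1..n}. splits_at k \<sigma>}"
    by blast
  then have "card {k. \<not> splits_at k \<sigma>} = n - h n \<sigma>"
    by (subst h_eq[OF assms]) (simp add: card_Diff_subset subset_iff)
  \<comment> \<open>The difference just obtained is truncated subtraction; this bound identifies it
    with the real difference in \<open>H\<close>.\<close>
  moreover have "h n \<sigma> \<le> n"
    unfolding h_eq[OF assms] using card_mono[of "{1..n}" "{k \<in> {1..n}. splits_at k \<sigma>}"]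
    by (simp add: subset_iff)
  ultimately show ?thesis
    by (simp add: H_def)
qed

section \<open>Subgroups of permutations splitting at a point\<close>

text \<open>For \<open>k\<close> in \<open>{1..n}\<close> this is the Young subgroup stabilising
  \<open>{1..<k}\<close>, \<open>{k}\<close> and \<open>{k<..n}\<close>.\<close>

definition split_subgroup :: "nat \<Rightarrow> nat \<Rightarrow> (nat \<Rightarrow> nat) set" where
  "split_subgroup n k = {\<sigma>. \<sigma> permutes {1..n} \<and> splits_at k \<sigma>}"

lemma subgroup_split_subgroup: "subgroup (split_subgroup n k) (sym_group n)"
proof (rule group.subgroupI)
  show "group (sym_group n)"
    by (rule sym_group_is_group)
  have "id \<in> split_subgroup n k"
    by (simp add: split_subgroup_def splits_at_def)
  then show "split_subgroup n k \<noteq> {}"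
    by blast
  show "inv\<^bsub>sym_group n\<^esub> \<sigma> \<in> split_subgroup n k" if "\<sigma> \<in> split_subgroup n k" for \<sigma>
  proof -
    have \<sigma>: "\<sigma> permutes {1..n}" "splits_at k \<sigma>"
      using that by (auto simp: split_subgroup_def)
    then have "splits_at k (inv' \<sigma>)"
      unfolding splits_at_def by (metis permutes_inverses)
    with \<sigma>(1) have "inv' \<sigma> \<in> split_subgroup n k"
      by (simp add: split_subgroup_def permutes_inv)
    then show ?thesis
      using \<sigma>(1) by (simp add: sym_group_inv_equality sym_group_carrier)
  qed
  show "\<sigma> \<otimes>\<^bsub>sym_group n\<^esub> \<tau> \<in> split_subgroup n k"
    if "\<sigma> \<in> split_subgroup n k" "\<tau> \<in> split_subgroup n k" for \<sigma> \<tau>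
    using that by (simp add: split_subgroup_def splits_at_def sym_group_mult permutes_compose)
qed (auto simp: split_subgroup_def sym_group_carrier)

lemma h_eq_card_subgroups:
  assumes "\<sigma> \<in> carrier (sym_group n)"
  shows "h n \<sigma> = card {k \<in> {1..n}. \<sigma> \<in> split_subgroup n k}"
  using assms by (simp add: h_eq sym_group_carrier split_subgroup_def)

lemma h_eq_sum_subgroups:
  assumes "\<sigma> \<in> carrier (sym_group n)"
  shows "h n \<sigma> = (\<Sum>k=1..n. of_bool (\<sigma> \<in> split_subgroup n k))"
  unfolding h_eq_card_subgroups[OF assms] by (simp add: of_bool_def sum.inter_filter[symmetric])

text \<open>A subgroup contains an element iff it contains its inverse. This yields the Hermitian
  clause for \<open>H\<close>, whose values are real.\<close>

lemma h_inv:
  assumes "\<sigma> \<in> carrier (sym_group n)"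
  shows "h n (inv\<^bsub>sym_group n\<^esub> \<sigma>) = h n \<sigma>"
proof -
  interpret group "sym_group n"
    by (rule sym_group_is_group)
  have "inv\<^bsub>sym_group n\<^esub> \<sigma> \<in> split_subgroup n k \<longleftrightarrow>
    \<sigma> \<in> split_subgroup n k" for k
    using subgroup.m_inv_closed[OF subgroup_split_subgroup[of n k]] assms inv_inv inv_closed by metis
  then show ?thesis
    using assms by (simp only: h_eq_card_subgroups inv_closed)
qed

section \<open>Definiteness of \<open>h\<close>, \<open>H\<close> and their exponentials\<close>

lemma positive_definite_power_h:
  assumes "b \<ge> 1"
  shows "positive_definite (sym_group n) (\<lambda>\<sigma>. complex_of_real (b ^ h n \<sigma>))"
proof -
  interpret group "sym_group n"
    by (rule sym_group_is_group)
  have "positive_definite (sym_group n) (\<lambda>\<sigma>. complex_of_real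
      (b ^ card {k \<in> {1..n}. \<sigma> \<in> split_subgroup n k}))"
    using positive_definite_power_card_subgroups[of "{1..n}" "split_subgroup n" b]
      subgroup_split_subgroup assms by simp
  then show ?thesis
    by (subst positive_definite_cong[OF is_group]) (simp_all only: h_eq_card_subgroups)
qed

lemma positive_definite_h: "positive_definite (sym_group n) (\<lambda>\<sigma>. complex_of_real (h n \<sigma>))"
proof -
  interpret group "sym_group n"
    by (rule sym_group_is_group)
  have "positive_definite (sym_group n) (\<lambda>\<sigma>. \<Sum>k=1..n.
      of_bool (\<sigma> \<in> split_subgroup n k))"
    by (intro positive_definite_sum positive_definite_subgroup subgroup_split_subgroup)
  then show ?thesis
    by (subst positive_definite_cong[OF is_group]) (simp_all add: h_eq_sum_subgroups)
qed

text \<open>\<open>H\<close> is a constant minus the positive definite \<open>h\<close>, so the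
  definition is verified directly, without a limit of the exponentials.\<close>

lemma conditionally_negative_definite_H:
  "conditionally_negative_definite (sym_group n) (\<lambda>\<sigma>. complex_of_real (H n \<sigma>))"
proof -
  interpret group "sym_group n"
    by (rule sym_group_is_group)
  have "conditionally_negative_definite (sym_group n)
      (\<lambda>\<sigma>. complex_of_real (real n) - complex_of_real (h n \<sigma>))"
    by (rule conditionally_negative_definite_const_minus[OF positive_definite_h])
      (simp only: h_inv complex_cnj_complex_of_real)
  then show ?thesis
    by (simp add: H_def)
qed

lemma positive_definite_exp_H:
  assumes "x \<ge> 0"
  shows "positive_definite (sym_group n) (\<lambda>\<sigma>. complex_of_real (exp (- x * H n \<sigma>)))"
proof -
  \<comment> \<open>A positive constant times a power of \<open>h\<close> with base
    \<open>exp x\<close>, which is at least 1 because \<open>x \<ge> 0\<close>.\<close>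
  have "exp (- x * H n \<sigma>) = exp (- x * n) * exp x ^ h n \<sigma>" for \<sigma>
    by (simp add: H_def exp_of_nat_mult[symmetric] exp_add[symmetric] algebra_simps)
  then show ?thesis
    using positive_definite_cmult[OF positive_definite_power_h, of "exp x" "exp (- x * n)" n] assms
    by simp
qed

section \<open>Passage to the infinite symmetric group\<close>

lemma carrier_sym_group_mono: "m \<le> n \<Longrightarrow> carrier (sym_group m) \<subseteq> carrier (sym_group n)"
  using permutes_subset[of _ "{1..m}" "{1..n}"] by (simp add: subset_iff sym_group_carrier)

lemma H_stable:
  assumes "\<sigma> \<in> carrier (sym_group m)" and "\<sigma> \<in> carrier (sym_group n)"
  shows "H m \<sigma> = H n \<sigma>"
  using assms by (simp add: H_eq sym_group_def)

lemma ex1_H_extension: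
  "\<exists>!Hinf. Hinf \<in> S_infinity \<rightarrow>\<^sub>E (UNIV :: real set) \<and>
     (\<forall>m \<ge> 1. \<forall>\<sigma> \<in> carrier (sym_group m). Hinf \<sigma> = H m \<sigma>)"
proof (rule ex1I)
  \<comment> \<open>The degree-free count from \<open>H_eq\<close> serves as witness. Restricting it
    makes it \<open>undefined\<close> off \<open>S_infinity\<close>, as the extensional function
    space demands; this gives uniqueness as a total function.\<close>
  let ?Hinf = "\<lambda>\<sigma>\<in>S_infinity. real (card {k. \<not> splits_at k \<sigma>})"
  have Hinf: "?Hinf \<sigma> = H m \<sigma>" if "m \<ge> 1" "\<sigma> \<in> carrier (sym_group m)" for m \<sigma>
  proof -
    have "\<sigma> \<in> S_infinity"
      using that by (auto simp: S_infinity_def)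
    then show ?thesis
      using that(2) by (simp add: H_eq sym_group_def)
  qed
  then show "?Hinf \<in> S_infinity \<rightarrow>\<^sub>E UNIV \<and> (\<forall>m\<ge>1. \<forall>\<sigma>\<in>carrier (sym_group m). ?Hinf \<sigma> = H m \<sigma>)"
    by auto
  fix F :: "(nat \<Rightarrow> nat) \<Rightarrow> real"
  assume F: "F \<in> S_infinity \<rightarrow>\<^sub>E UNIV \<and> (\<forall>m\<ge>1. \<forall>\<sigma>\<in>carrier (sym_group m). F \<sigma> = H m \<sigma>)"
  show "F = ?Hinf"
  proof (rule PiE_ext)
    show "F \<in> S_infinity \<rightarrow>\<^sub>E UNIV"
      using F by blast
    show "F \<sigma> = ?Hinf \<sigma>" if \<sigma>: "\<sigma> \<in> S_infinity" for \<sigma>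
    proof -
      obtain m where m: "m \<ge> 1" "\<sigma> \<in> carrier (sym_group m)"
        using \<sigma> by (auto simp: S_infinity_def)
      then have "F \<sigma> = H m \<sigma>"
        using F by blast
      with Hinf[OF m] show ?thesis by simp
    qed
  qed auto
qed

theorem corollary2:
  fixes n :: nat
  assumes "n \<ge> 1"
  shows "(\<forall>b::real. b \<ge> 1 \<longrightarrow>
            positive_definite (sym_group n) (\<lambda>\<sigma>. complex_of_real (b ^ h n \<sigma>)))
       \<and> (conditionally_negative_definite (sym_group n) (\<lambda>\<sigma>. complex_of_real (H n \<sigma>)) \<and>
          (\<forall>x::real. x > 0 \<longrightarrow>
            positive_definite (sym_group n) (\<lambda>\<sigma>. complex_of_real (exp (- x * H n \<sigma>)))))
       \<and> (carrier (sym_group n) \<subseteq> carrier (sym_group (n + 1)) \<and>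
          (\<forall>\<sigma> \<in> carrier (sym_group n). H n \<sigma> = H (n + 1) \<sigma>) \<and>
          (\<exists>!Hinf. Hinf \<in> S_infinity \<rightarrow>\<^sub>E (UNIV :: real set) \<and>
             (\<forall>m \<ge> 1. \<forall>\<sigma> \<in> carrier (sym_group m). Hinf \<sigma> = H m \<sigma>)))"
proof -
  have "carrier (sym_group n) \<subseteq> carrier (sym_group (n + 1))"
    by (rule carrier_sym_group_mono) simp
  moreover from this have "\<forall>\<sigma> \<in> carrier (sym_group n). H n \<sigma> = H (n + 1) \<sigma>"
    using H_stable by blast
  ultimately show ?thesis
    by (intro conjI allI impI positive_definite_power_h conditionally_negative_definite_H
        positive_definite_exp_H[OF less_imp_le] ex1_H_extension)
qed

end
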